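(* Let $1<r_1<\dots<r_l$ be integers, let $\alpha_1,\dots,\alpha_l$ be positive constants with $\sum_{i=1}^{l}\frac{\alpha_i}{(r_i-1)!}\le 1$, and let $m,t$ be positive integers with $$t+\sum_{i=1}^{l}\binom{t}{r_i}<m\le t+1+\sum_{i=1}^{l}\binom{t+1}{r_i}.$$ Let $T=\{1,r_1,\dots,r_l\}$ and $Q=\{r_1,\dots,r_l\}$. Let $H$ be a $T$-hypergraph with $m$ edges and $n$ vertices. Suppose that every $Q$-hypergraph $G$ with $m-t-1$ edges and $n$ vertices satisfies $\Phi(G)\le \Phi(C_{m-t-1,Q})$. Then $L(H)\le L(C_{m,T})$.
   Context: A hypergraph $H=(V,E)$ has edges that are subsets of $V$; $T(H)=\{|e|:e\in E\}$, and a $T$-hypergraph is one with $T(H)=T$. For distinct finite sets $A,B\subset\mathbb{N}$, $A$ precedes $B$ in the colex ordering if $\max(A\triangle B)\in B$. For a set $T$ of positive integers, $C_{m,T}$ denotes the hypergraph whose edge set is the first $m$ sets, in colex ordering, among all finite subsets of $\mathbb{N}$ whose size lies in $T$. Let $S$ be the standard simplex $\{\vec x:\sum_i x_i=1,\ x_i\ge 0\}$ in $\mathbb{R}^{V}$. For a $T$-hypergraph $H$ and $\vec x\in S$, $$L(H,\vec x)=\sum_{\{i\}\in E}x_i+\sum_{k=1}^{l}\alpha_k\sum_{e\in E,\ |e|=r_k}\prod_{i\in e}x_i,\qquad L(H)=\max_{\vec x\in S}L(H,\vec x).$$ For a hypergraph $G$ with edge types in $Q$, $$\Phi(G,\vec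 x)=\sum_{k=1}^{l}\alpha_k\sum_{e\in E(G),\ |e|=r_k}\prod_{i\in e}x_i,\qquad \Phi(G)=\max_{\vec x\in S}\Phi(G,\vec x).$$ *)

theory Defs
  imports "HOL-Analysis.Analysis"
begin

(* A hypergraph is a pair of its vertex set and its edge set; isolated vertices are allowed. *)
type_synonym 'a hypergraph = "'a set \<times> 'a set set"

abbreviation verts :: "'a hypergraph \<Rightarrow> 'a set" where
  "verts H \<equiv> fst H"

abbreviation edges :: "'a hypergraph \<Rightarrow> 'a set set" where
  "edges H \<equiv> snd H"

definition hypergraph :: "'a hypergraph \<Rightarrow> bool" where
  "hypergraph H \<longleftrightarrow> finite (verts H) \<and> (\<forall>e\<in>edges H. e \<subseteq> verts H)"

definition edge_types :: "'a hypergraph \<Rightarrow> nat set" where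
  "edge_types H = card ` edges H"

(* Every size in T must occur among the edges, and no other size may. *)
definition T_hypergraph :: "nat set \<Rightarrow> 'a hypergraph \<Rightarrow> bool" where
  "T_hypergraph T H \<longleftrightarrow> hypergraph H \<and> edge_types H = T"

definition colex_less :: "nat set \<Rightarrow> nat set \<Rightarrow> bool" where
  "colex_less A B \<longleftrightarrow> A \<noteq> B \<and> Max ((A - B) \<union> (B - A)) \<in> B"

definition colex_predecessors :: "nat set \<Rightarrow> nat set \<Rightarrow> nat set set" where
  "colex_predecessors T A = {B. finite B \<and> card B \<in> T \<and> colex_less B A}"

(* A set is among the first m iff fewer than m sets precede it; the cardinality used here is
   meaningful because every finite set has finitely many predecessors (lemma below). *)
definition colex_edges :: "nat \<Rightarrow> nat set \<Rightarrow> nat set set" where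
  "colex_edges m T = {A. finite A \<and> card A \<in> T \<and> card (colex_predecessors T A) < m}"

(* The vertices of C(m,T) are those covered by its edges. *)
definition colex_hypergraph :: "nat \<Rightarrow> nat set \<Rightarrow> nat hypergraph" where
  "colex_hypergraph m T = (\<Union>(colex_edges m T), colex_edges m T)"

lemma finite_colex_predecessors:
  assumes "finite A"
  shows "finite (colex_predecessors T A)"
proof (rule finite_subset)
  show "colex_predecessors T A \<subseteq> Pow {..Max A}"
  proof
    fix B assume "B \<in> colex_predecessors T A"
    then have fB: "finite B" and M: "Max ((B - A) \<union> (A - B)) \<in> A"
      by (auto simp: colex_predecessors_def colex_less_def)
    have "x \<le> Max A" if "x \<in> B" for x
    proof (cases "x \<in> A")
      case True
      then show ?thesis using assms by simp
    next
      case False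
      then have "x \<le> Max ((B - A) \<union> (A - B))"
        using that fB assms by (intro Max_ge) auto
      also have "\<dots> \<le> Max A"
        using M assms by simp
      finally show ?thesis .
    qed
    then show "B \<in> Pow {..Max A}" by auto
  qed
qed simp

(* A point of the coordinate space indexed by V is a function on 'a that is 0 outside V. *)
definition std_simplex :: "'a set \<Rightarrow> ('a \<Rightarrow> real) set" where
  "std_simplex V = {x. (\<forall>i\<in>V. 0 \<le> x i) \<and> (\<forall>i. i \<notin> V \<longrightarrow> x i = 0) \<and> (\<Sum>i\<in>V. x i) = 1}"

definition Phi_at ::
  "nat \<Rightarrow> (nat \<Rightarrow> real) \<Rightarrow> (nat \<Rightarrow> nat) \<Rightarrow> 'a hypergraph \<Rightarrow> ('a \<Rightarrow> real) \<Rightarrow> real" where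
  "Phi_at l \<alpha> r G x = (\<Sum>k=1..l. \<alpha> k * (\<Sum>e\<in>{e\<in>edges G. card e = r k}. \<Prod>i\<in>e. x i))"

definition L_at ::
  "nat \<Rightarrow> (nat \<Rightarrow> real) \<Rightarrow> (nat \<Rightarrow> nat) \<Rightarrow> 'a hypergraph \<Rightarrow> ('a \<Rightarrow> real) \<Rightarrow> real" where
  "L_at l \<alpha> r H x =
     (\<Sum>i\<in>{i. {i} \<in> edges H}. x i)
     + (\<Sum>k=1..l. \<alpha> k * (\<Sum>e\<in>{e\<in>edges H. card e = r k}. \<Prod>i\<in>e. x i))"

(* For a finite nonempty vertex set the simplex is compact and nonempty, so these suprema of
   polynomial functions are maxima. *)
definition Phi :: "nat \<Rightarrow> (nat \<Rightarrow> real) \<Rightarrow> (nat \<Rightarrow> nat) \<Rightarrow> 'a hypergraph \<Rightarrow> real" where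
  "Phi l \<alpha> r G = (SUP x\<in>std_simplex (verts G). Phi_at l \<alpha> r G x)"

definition L :: "nat \<Rightarrow> (nat \<Rightarrow> real) \<Rightarrow> (nat \<Rightarrow> nat) \<Rightarrow> 'a hypergraph \<Rightarrow> real" where
  "L l \<alpha> r H = (SUP x\<in>std_simplex (verts H). L_at l \<alpha> r H x)"

end

theory Submission
  imports Defs
begin

text \<open>
  Since \<open>C(m,T)\<close> consists of the singletons \<open>{0},\<dots>,{t}\<close> and of the edges of \<open>C(m-t-1,Q)\<close>, its
  Lagrangian is \<open>1 + \<Phi>(C(m-t-1,Q))\<close>. Let \<open>U\<close> be the set of vertices \<open>i\<close> with \<open>{i} \<in> E(H)\<close>.

  If \<open>\<bar>U\<bar> > t\<close>, then \<open>H\<close> has at most \<open>m-t-1\<close> edges with sizes in \<open>Q\<close>. Adding edges, one gets a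
  \<open>Q\<close>-hypergraph with exactly \<open>m-t-1\<close> edges, to which the hypothesis on \<open>\<Phi>\<close> applies.

  If \<open>\<bar>U\<bar> \<le> t\<close>, then by the bound on the \<open>\<alpha>\<^sub>i\<close> the edges with sizes in \<open>Q\<close> through a
  vertex \<open>i \<notin> U\<close> contribute at most \<open>x\<^sub>i\<close>, so replacing all of them by the edge \<open>{i}\<close> does
  not decrease \<open>L(H,x)\<close>. What remains lies inside \<open>U\<close>, and \<open>C(m,T)\<close> contains all edges within
  \<open>t\<close> vertices.
\<close>

text \<open>The sets inside \<open>{..<N}\<close> form an initial segment of the colex ordering, so
  comparing \<open>m\<close> with \<open>card (sized_subsets {..<N} K)\<close> locates the first
  \<open>m\<close> sets.\<close>

definition sized_subsets :: "'a set \<Rightarrow> nat set \<Rightarrow> 'a set set" where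
  "sized_subsets X K = {e. e \<subseteq> X \<and> card e \<in> K}"

lemma finite_sized_subsets: "finite X \<Longrightarrow> finite (sized_subsets X K)"
  unfolding sized_subsets_def by (rule finite_subset[of _ "Pow X"]) auto

lemma card_sized_subsets:
  assumes "finite X" "finite K"
  shows "card (sized_subsets X K) = (\<Sum>k\<in>K. card X choose k)"
proof -
  have "sized_subsets X K = (\<Union>k\<in>K. {e. e \<subseteq> X \<and> card e = k})"
    by (auto simp: sized_subsets_def)
  also have "card \<dots> = (\<Sum>k\<in>K. card {e. e \<subseteq> X \<and> card e = k})"
    using assms by (intro card_UN_disjoint) auto
  also have "\<dots> = (\<Sum>k\<in>K. card X choose k)"
    using assms by (intro sum.cong refl n_subsets)
  finally show ?thesis .
qed

section \<open>The colex ordering\<close>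

lemma colex_less_imp_subset:
  assumes "colex_less B A" "finite A" "finite B" "A \<subseteq> {..<N}"
  shows "B \<subseteq> {..<N}"
proof
  fix x assume "x \<in> B"
  show "x \<in> {..<N}"
  proof (cases "x \<in> A")
    case False
    with \<open>x \<in> B\<close> assms have "x \<le> Max ((B - A) \<union> (A - B))"
      by (intro Max_ge) auto
    moreover have "Max ((B - A) \<union> (A - B)) \<in> A"
      using assms by (auto simp: colex_less_def)
    ultimately show ?thesis using assms(4) by fastforce
  qed (use assms in auto)
qed

text \<open>The maximum of the symmetric difference must be \<open>i\<close>, so all of
  \<open>B\<close> lies below \<open>i\<close>. This is sharper by one than
  \<open>colex_less_imp_subset\<close>, which is what puts \<open>{t}\<close> itself among the first
  \<open>m\<close> sets.\<close>

lemma colex_less_singleton_imp_subset: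
  assumes "colex_less B {i}" "finite B"
  shows "B \<subseteq> {..<i}"
proof
  fix x assume x: "x \<in> B"
  let ?D = "(B - {i}) \<union> ({i} - B)"
  have D: "?D \<noteq> {}" "finite ?D" "Max ?D = i"
    using assms by (auto simp: colex_less_def)
  from Max_in[OF D(2,1)] D(3) have "i \<notin> B" by auto
  with x have "x \<in> ?D" "x \<noteq> i" by auto
  with Max_ge[OF D(2) this(1)] D(3) show "x \<in> {..<i}" by simp
qed

lemma colex_less_of_subset:
  assumes "B \<subseteq> {..<N}" "finite A" "a \<in> A" "N \<le> a"
  shows "colex_less B A"
proof -
  let ?D = "(B - A) \<union> (A - B)"
  have fin: "finite ?D" using assms finite_subset by blast
  have a: "a \<in> ?D" using assms by auto
  have "a \<le> Max ?D" using a fin by (rule Max_ge[rotated])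
  moreover have "Max ?D \<in> ?D" using fin a by (intro Max_in) auto
  ultimately have "Max ?D \<in> A" using assms by auto
  then show ?thesis using assms by (auto simp: colex_less_def)
qed

text \<open>A predecessor would lie inside \<open>{..<q}\<close> and have at least \<open>q\<close>
  elements, hence be \<open>{..<q}\<close> itself.\<close>

lemma colex_predecessors_empty:
  assumes "\<forall>k\<in>K. q \<le> k"
  shows "colex_predecessors K {..<q} = {}"
proof (rule ccontr)
  assume "colex_predecessors K {..<q} \<noteq> {}"
  then obtain B where B: "finite B" "card B \<in> K" "colex_less B {..<q}"
    by (auto simp: colex_predecessors_def)
  have sub: "B \<subseteq> {..<q}" by (rule colex_less_imp_subset[OF B(3) _ B(1)]) simp_all
  have "card B = card {..<q}" using card_mono[OF _ sub] assms B(2) by (simp add: antisym)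
  then have "B = {..<q}" using sub by (intro card_subset_eq) auto
  with B show False by (simp add: colex_less_def)
qed

lemma colex_edges_subset:
  assumes "m \<le> card (sized_subsets {..<N} K)"
  shows "colex_edges m K \<subseteq> sized_subsets {..<N} K"
proof
  fix A assume A: "A \<in> colex_edges m K"
  then have fin: "finite A" by (simp add: colex_edges_def)
  have "a < N" if "a \<in> A" for a
  proof (rule ccontr)
    assume "\<not> a < N"
    then have "sized_subsets {..<N} K \<subseteq> colex_predecessors K A"
      using that fin colex_less_of_subset[of _ N A a] finite_subset
      by (fastforce simp: sized_subsets_def colex_predecessors_def)
    then have "card (sized_subsets {..<N} K) \<le> card (colex_predecessors K A)"
      by (intro card_mono finite_colex_predecessors fin)
    with A assms show False by (simp add: colex_edges_def)
  qed
  with A show "A \<in> sized_subsets {..<N} K"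
    by (auto simp: sized_subsets_def colex_edges_def)
qed

text \<open>The containment is required of the predecessors rather than of \<open>A\<close>, so that
  \<open>A = {t}\<close> with \<open>N = t\<close> is covered too.\<close>

lemma colex_edges_memI:
  assumes "finite A" "card A \<in> K" "card (sized_subsets {..<N} K) < m"
    and "\<And>B. finite B \<Longrightarrow> colex_less B A \<Longrightarrow> B \<subseteq> {..<N}"
  shows "A \<in> colex_edges m K"
proof -
  have "colex_predecessors K A \<subseteq> sized_subsets {..<N} K"
    using assms(4) by (auto simp: colex_predecessors_def sized_subsets_def)
  then have "card (colex_predecessors K A) \<le> card (sized_subsets {..<N} K)"
    by (intro card_mono finite_sized_subsets) auto
  with assms show ?thesis by (simp add: colex_edges_def)
qed

text \<open>Among the subsets of \<open>{0,\<dots>,t}\<close>, at most \<open>t + 1\<close> singletons precede any given one.\<close>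

lemma colex_edges_insert_1:
  assumes "A \<in> colex_edges m' K" "A \<subseteq> {..<Suc t}"
  shows "A \<in> colex_edges (m' + Suc t) (insert 1 K)"
proof -
  have fin: "finite A" using assms by (simp add: colex_edges_def)
  have "colex_predecessors (insert 1 K) A \<subseteq> colex_predecessors K A \<union> (\<lambda>i. {i}) ` {..<Suc t}"
  proof
    fix B assume B: "B \<in> colex_predecessors (insert 1 K) A"
    then have "B \<subseteq> {..<Suc t}"
      using fin assms(2) by (auto simp: colex_predecessors_def dest!: colex_less_imp_subset)
    with B show "B \<in> colex_predecessors K A \<union> (\<lambda>i. {i}) ` {..<Suc t}"
      by (auto simp: colex_predecessors_def card_1_singleton_iff)
  qed
  then have "card (colex_predecessors (insert 1 K) A)
      \<le> card (colex_predecessors K A \<union> (\<lambda>i. {i}) ` {..<Suc t})"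
    by (intro card_mono) (auto intro: finite_colex_predecessors[OF fin])
  also have "\<dots> \<le> card (colex_predecessors K A) + card ((\<lambda>i. {i}) ` {..<Suc t})"
    by (rule card_Un_le)
  also have "\<dots> \<le> card (colex_predecessors K A) + Suc t"
    using card_image_le[of "{..<Suc t}" "\<lambda>i. {i}"] by simp
  also have "\<dots> < m' + Suc t"
    using assms by (simp add: colex_edges_def)
  finally show ?thesis using assms fin by (simp add: colex_edges_def)
qed

section \<open>Sums over edges\<close>

text \<open>Only the terms of the binomial expansion of degree at most one in \<open>a\<close> are
  kept; \<open>elementary_symmetric_le\<close> needs just these when a vertex of weight
  \<open>a\<close> is added.\<close>

lemma power_add_ge:
  fixes a b :: real
  assumes "0 \<le> a" "0 \<le> b"
  shows "b ^ Suc k + real (Suc k) * a * b ^ k \<le> (a + b) ^ Suc k"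
proof (induction k)
  case (Suc k)
  have "b ^ Suc (Suc k) + real (Suc (Suc k)) * a * b ^ Suc k
      \<le> (a + b) * (b ^ Suc k + real (Suc k) * a * b ^ k)"
  proof -
    \<comment> \<open>This product is exactly the excess of the right side over the left after
      multiplying out.\<close>
    have "0 \<le> real (Suc k) * a * a * b ^ k" using assms by simp
    then show ?thesis by (simp add: algebra_simps)
  qed
  also have "\<dots> \<le> (a + b) * (a + b) ^ Suc k"
    using Suc assms by (intro mult_left_mono) auto
  finally show ?case by simp
qed simp

text \<open>In the expansion of the \<open>k\<close>-th power of the sum, each product over a
  \<open>k\<close>-set occurs \<open>k!\<close> times. The induction splits the sets by whether they
  contain the new vertex; removing it lowers \<open>k\<close>, so \<open>k\<close> stays
  arbitrary.\<close>

lemma elementary_symmetric_le: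
  fixes x :: "'a \<Rightarrow> real"
  assumes "finite V" "\<And>i. i \<in> V \<Longrightarrow> 0 \<le> x i"
  shows "(\<Sum>e\<in>sized_subsets V {k}. \<Prod>i\<in>e. x i) \<le> (\<Sum>i\<in>V. x i) ^ k / fact k"
  using assms
proof (induction V arbitrary: k rule: finite_induct)
  case empty
  have "sized_subsets ({} :: 'a set) {k} = (if k = 0 then {{}} else {})"
    by (auto simp: sized_subsets_def)
  then show ?case by simp
next
  case (insert a V)
  show ?case
  proof (cases k)
    case 0
    have "sized_subsets (insert a V) {k} = {{}}"
      using insert.hyps(1) 0 by (auto simp: sized_subsets_def dest: finite_subset)
    then show ?thesis using 0 by simp
  next
    case (Suc j)
    have split: "sized_subsets (insert a V) {Suc j}
        = sized_subsets V {Suc j} \<union> insert a ` sized_subsets V {j}" (is "?L = ?A \<union> ?B")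
    proof (intro equalityI subsetI)
      fix e assume e: "e \<in> ?L"
      then have fin: "finite e"
        using insert.hyps(1) by (auto simp: sized_subsets_def intro: finite_subset)
      show "e \<in> ?A \<union> ?B"
      proof (cases "a \<in> e")
        case True
        then have "e = insert a (e - {a})" "e - {a} \<in> sized_subsets V {j}"
          using e fin by (auto simp: sized_subsets_def)
        then show ?thesis by blast
      qed (use e in \<open>auto simp: sized_subsets_def\<close>)
    next
      fix e assume "e \<in> ?A \<union> ?B"
      then show "e \<in> ?L"
      proof
        assume "e \<in> ?B"
        then obtain d where d: "e = insert a d" "d \<subseteq> V" "card d = j"
          by (auto simp: sized_subsets_def)
        moreover have "finite d" "a \<notin> d"
          using d insert.hyps by (auto intro: finite_subset)
        ultimately show ?thesis by (auto simp: sized_subsets_def)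
      qed (auto simp: sized_subsets_def)
    qed
    have disj: "?A \<inter> ?B = {}"
      using insert.hyps by (auto simp: sized_subsets_def)
    have inj: "inj_on (insert a) (sized_subsets V {j})"
    proof (rule inj_onI)
      fix d e assume "d \<in> sized_subsets V {j}" "e \<in> sized_subsets V {j}" "insert a d = insert a e"
      with insert.hyps(2) show "d = e" by (intro insert_ident[THEN iffD1, of a d e]) (auto simp: sized_subsets_def)
    qed
    have B: "(\<Sum>e\<in>?B. \<Prod>i\<in>e. x i) = x a * (\<Sum>e\<in>sized_subsets V {j}. \<Prod>i\<in>e. x i)"
    proof -
      have "(\<Sum>e\<in>?B. \<Prod>i\<in>e. x i) = (\<Sum>e\<in>sized_subsets V {j}. \<Prod>i\<in>insert a e. x i)"
        using inj by (simp add: sum.reindex)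
      also have "\<dots> = (\<Sum>e\<in>sized_subsets V {j}. x a * (\<Prod>i\<in>e. x i))"
      proof (intro sum.cong refl)
        fix e assume "e \<in> sized_subsets V {j}"
        then have "finite e" "a \<notin> e"
          using insert.hyps by (auto simp: sized_subsets_def intro: finite_subset)
        then show "(\<Prod>i\<in>insert a e. x i) = x a * (\<Prod>i\<in>e. x i)" by simp
      qed
      finally show ?thesis by (simp add: sum_distrib_left)
    qed
    let ?s = "\<Sum>i\<in>V. x i"
    have nn: "0 \<le> ?s" "0 \<le> x a" using insert.prems by (auto intro: sum_nonneg)
    have "(\<Sum>e\<in>?L. \<Prod>i\<in>e. x i)
        = (\<Sum>e\<in>?A. \<Prod>i\<in>e. x i) + x a * (\<Sum>e\<in>sized_subsets V {j}. \<Prod>i\<in>e. x i)"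
      unfolding split B[symmetric] using disj insert.hyps(1)
      by (intro sum.union_disjoint) (auto intro: finite_sized_subsets)
    also have "\<dots> \<le> ?s ^ Suc j / fact (Suc j) + x a * (?s ^ j / fact j)"
      using insert.IH[of "Suc j"] insert.IH[of j] insert.prems nn
      by (intro add_mono mult_left_mono) (auto simp del: fact_Suc power_Suc)
    also have "\<dots> = (?s ^ Suc j + real (Suc j) * x a * ?s ^ j) / fact (Suc j)"
      by (simp add: add_divide_distrib del: power_Suc of_nat_Suc)
    also have "\<dots> \<le> (x a + ?s) ^ Suc j / fact (Suc j)"
      using power_add_ge[OF nn(2) nn(1), of j] by (intro divide_right_mono) auto
    finally show ?thesis using Suc insert.hyps by simp
  qed
qed

text \<open>Removing \<open>i\<close> turns the edges through \<open>i\<close> into distinct sets of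
  size \<open>k - 1\<close>, so the factor beside \<open>x i\<close> is bounded by
  \<open>elementary_symmetric_le\<close> with total mass 1.\<close>

lemma link_sum_le:
  fixes x :: "'a \<Rightarrow> real"
  assumes x: "x \<in> std_simplex V" and "finite V" "0 < k" "i \<in> V" "F \<subseteq> sized_subsets V {k}"
  shows "(\<Sum>e\<in>{e\<in>F. i \<in> e}. \<Prod>j\<in>e. x j) \<le> x i / fact (k - 1)"
proof -
  have nn: "\<And>j. j \<in> V \<Longrightarrow> 0 \<le> x j" using x by (auto simp: std_simplex_def)
  let ?F = "{e\<in>F. i \<in> e}" and ?S = "sized_subsets V {k - 1}"
  have fin: "finite e" if "e \<in> ?F" for e
    using that assms by (auto simp: sized_subsets_def intro: finite_subset)
  have inj: "inj_on (\<lambda>e. e - {i}) ?F"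
    by (rule inj_onI) (metis (no_types, lifting) insert_Diff mem_Collect_eq)
  have sub: "(\<lambda>e. e - {i}) ` ?F \<subseteq> ?S"
    using assms fin by (auto simp: sized_subsets_def)
  have "(\<Sum>e\<in>?F. \<Prod>j\<in>e. x j) = (\<Sum>e\<in>?F. x i * (\<Prod>j\<in>e - {i}. x j))"
    using fin by (intro sum.cong refl prod.remove) auto
  also have "\<dots> = x i * (\<Sum>e\<in>(\<lambda>e. e - {i}) ` ?F. \<Prod>j\<in>e. x j)"
    using inj by (simp add: sum.reindex sum_distrib_left)
  also have "\<dots> \<le> x i * (\<Sum>e\<in>?S. \<Prod>j\<in>e. x j)"
    using sub nn assms(2,4)
    by (intro mult_left_mono sum_mono2 finite_sized_subsets prod_nonneg)
       (auto simp: sized_subsets_def)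
  also have "\<dots> \<le> x i * ((\<Sum>j\<in>V. x j) ^ (k - 1) / fact (k - 1))"
    using assms nn by (intro mult_left_mono elementary_symmetric_le) auto
  also have "\<dots> = x i / fact (k - 1)"
    using x by (simp add: std_simplex_def)
  finally show ?thesis .
qed

lemma edge_sum_le_induced:
  fixes x :: "'a \<Rightarrow> real"
  assumes x: "x \<in> std_simplex V" and fin: "finite V" and "0 < k" and F: "F \<subseteq> sized_subsets V {k}"
  shows "(\<Sum>e\<in>F. \<Prod>i\<in>e. x i)
      \<le> (\<Sum>e\<in>sized_subsets U {k} \<inter> F. \<Prod>i\<in>e. x i) + (\<Sum>i\<in>V - U. x i) / fact (k - 1)"
proof -
  have nn: "\<And>j. j \<in> V \<Longrightarrow> 0 \<le> x j" using x by (auto simp: std_simplex_def)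
  have finF: "finite F" using F fin finite_sized_subsets finite_subset by blast
  have pnn: "0 \<le> (\<Prod>i\<in>e. x i)" if "e \<in> F" for e
    using that F nn by (intro prod_nonneg) (auto simp: sized_subsets_def subset_iff)
  let ?R = "F - sized_subsets U {k}"
  have "(\<Sum>e\<in>F. \<Prod>i\<in>e. x i)
      = (\<Sum>e\<in>sized_subsets U {k} \<inter> F. \<Prod>i\<in>e. x i) + (\<Sum>e\<in>?R. \<Prod>i\<in>e. x i)"
    using sum.Int_Diff[OF finF, of _ "sized_subsets U {k}"] by (simp add: Int_commute)
  \<comment> \<open>Each remaining edge meets \<open>V - U\<close> and is charged to every vertex it
    has there; counting it repeatedly is harmless because the products are nonnegative.\<close>
  also have "(\<Sum>e\<in>?R. \<Prod>i\<in>e. x i) \<le> (\<Sum>e\<in>?R. \<Sum>i\<in>V - U. if i \<in> e then \<Prod>j\<in>e. x j else 0)"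
  proof (rule sum_mono)
    fix e assume e: "e \<in> ?R"
    then obtain i where i: "i \<in> e" "i \<in> V - U" using F by (auto simp: sized_subsets_def)
    have "(if i \<in> e then \<Prod>j\<in>e. x j else 0) \<le> (\<Sum>i\<in>V - U. if i \<in> e then \<Prod>j\<in>e. x j else 0)"
      using fin i pnn e by (intro member_le_sum) auto
    with i show "(\<Prod>i\<in>e. x i) \<le> (\<Sum>i\<in>V - U. if i \<in> e then \<Prod>j\<in>e. x j else 0)" by simp
  qed
  also have "\<dots> = (\<Sum>i\<in>V - U. \<Sum>e\<in>{e\<in>?R. i \<in> e}. \<Prod>j\<in>e. x j)"
    by (subst sum.swap, intro sum.cong refl sum.inter_filter[symmetric]) (use finF in simp)
  also have "\<dots> \<le> (\<Sum>i\<in>V - U. x i / fact (k - 1))"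
    using assms by (intro sum_mono link_sum_le[of x V]) auto
  also have "\<dots> = (\<Sum>i\<in>V - U. x i) / fact (k - 1)"
    by (simp add: sum_divide_distrib)
  finally show ?thesis by simp
qed

section \<open>Points of the simplex and boundedness of the polynomials\<close>

lemma std_simplex_range:
  assumes "finite V" "x \<in> std_simplex V"
  shows "0 \<le> x i" "x i \<le> 1"
proof -
  show "0 \<le> x i" using assms by (cases "i \<in> V") (auto simp: std_simplex_def)
  show "x i \<le> 1"
  proof (cases "i \<in> V")
    case True
    then have "x i \<le> (\<Sum>i\<in>V. x i)" using assms by (intro member_le_sum) (auto simp: std_simplex_def)
    then show ?thesis using assms by (simp add: std_simplex_def)
  qed (use assms in \<open>auto simp: std_simplex_def\<close>)
qed

lemma std_simplex_mono:
  assumes "x \<in> std_simplex V" "V \<subseteq> W" "finite W"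
  shows "x \<in> std_simplex W"
proof -
  have "(\<Sum>i\<in>W. x i) = (\<Sum>i\<in>V. x i)"
    using assms by (intro sum.mono_neutral_right) (auto simp: std_simplex_def)
  then show ?thesis using assms by (auto simp: std_simplex_def)
qed

lemma std_simplex_nonempty:
  assumes "finite V" "v \<in> V"
  shows "std_simplex V \<noteq> {}"
proof -
  have "(\<lambda>i. if i = v then 1 else 0 :: real) \<in> std_simplex V"
    using assms by (auto simp: std_simplex_def)
  then show ?thesis by blast
qed

lemma Phi_at_mono:
  assumes "edges G \<subseteq> edges G'" "finite (edges G')" "\<And>i. 0 \<le> x i" "\<forall>k\<in>{1..l}. 0 < \<alpha> k"
  shows "Phi_at l \<alpha> r G x \<le> Phi_at l \<alpha> r G' x"
  unfolding Phi_at_def using assms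
  by (intro sum_mono mult_left_mono sum_mono2 prod_nonneg) (auto simp: less_imp_le)

lemma L_at_eq: "L_at l \<alpha> r H x = (\<Sum>i\<in>{i. {i} \<in> edges H}. x i) + Phi_at l \<alpha> r H x"
  by (simp add: L_at_def Phi_at_def)

text \<open>Each product is at most 1. The resulting bound makes the real suprema in
  \<open>Phi\<close> and \<open>L\<close> dominate the values they range over.\<close>

lemma Phi_at_le_const:
  assumes "\<And>i. 0 \<le> x i" "\<And>i. x i \<le> 1" "\<forall>k\<in>{1..l}. 0 < \<alpha> k"
  shows "Phi_at l \<alpha> r G x \<le> (\<Sum>k=1..l. \<alpha> k * (\<Sum>e\<in>{e\<in>edges G. card e = r k}. 1))"
  unfolding Phi_at_def using assms
  by (intro sum_mono mult_left_mono prod_le_1) (auto simp: less_imp_le)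

lemma bdd_above_Phi_at:
  assumes "finite V" "\<forall>k\<in>{1..l}. 0 < \<alpha> k"
  shows "bdd_above (Phi_at l \<alpha> r G ` std_simplex V)"
  using assms std_simplex_range[OF assms(1)]
  by (intro bdd_aboveI2[where M = "\<Sum>k=1..l. \<alpha> k * (\<Sum>e\<in>{e\<in>edges G. card e = r k}. 1)"]
      Phi_at_le_const) auto

lemma singleton_sum_le:
  assumes "finite V" "x \<in> std_simplex V" "U \<subseteq> V"
  shows "(\<Sum>i\<in>U. x i) \<le> 1"
proof -
  have "(\<Sum>i\<in>U. x i) \<le> (\<Sum>i\<in>V. x i)"
    using assms by (intro sum_mono2) (auto simp: std_simplex_def)
  then show ?thesis using assms by (simp add: std_simplex_def)
qed

lemma bdd_above_L_at:
  assumes "hypergraph H" "\<forall>k\<in>{1..l}. 0 < \<alpha> k"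
  shows "bdd_above (L_at l \<alpha> r H ` std_simplex (verts H))"
proof -
  have fin: "finite (verts H)" and sub: "{i. {i} \<in> edges H} \<subseteq> verts H"
    using assms by (auto simp: hypergraph_def)
  obtain M where M: "\<And>x. x \<in> std_simplex (verts H) \<Longrightarrow> Phi_at l \<alpha> r H x \<le> M"
    using bdd_above_Phi_at[OF fin assms(2), of r H] by (auto simp: bdd_above_def)
  show ?thesis
    by (rule bdd_aboveI2[where M = "1 + M"])
       (use M singleton_sum_le[OF fin _ sub] in \<open>auto simp: L_at_eq intro: add_mono\<close>)
qed

section \<open>Comparison of the two hypergraphs\<close>

text \<open>By \<open>edge_sum_le_induced\<close> and the bound on the \<alpha>'s, the edges not
  inside \<open>U\<close> contribute at most the mass outside \<open>U\<close>. Inside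
  \<open>U\<close> the edge set is enlarged to all subsets, so only \<open>card U\<close> will
  matter.\<close>

lemma L_at_le_induced:
  assumes H: "hypergraph H" and x: "x \<in> std_simplex (verts H)"
    and r: "\<forall>k\<in>{1..l}. 1 < r k" and \<alpha>: "\<forall>k\<in>{1..l}. 0 < \<alpha> k"
    and \<alpha>_sum: "(\<Sum>k=1..l. \<alpha> k / fact (r k - 1)) \<le> 1"
  defines "U \<equiv> {i. {i} \<in> edges H}"
  shows "L_at l \<alpha> r H x \<le> 1 + Phi_at l \<alpha> r (U, Pow U) x"
proof -
  let ?V = "verts H"
  have fin: "finite ?V" and E: "\<And>e. e \<in> edges H \<Longrightarrow> e \<subseteq> ?V"
    using H by (auto simp: hypergraph_def)
  have U: "U \<subseteq> ?V" using E by (auto simp: U_def)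
  have nn: "\<And>i. 0 \<le> x i" using std_simplex_range[OF fin x] by auto
  let ?w = "\<Sum>i\<in>?V - U. x i"
  have w: "0 \<le> ?w" using nn by (intro sum_nonneg)
  have "Phi_at l \<alpha> r H x
      \<le> (\<Sum>k=1..l. \<alpha> k * ((\<Sum>e\<in>{e\<in>Pow U. card e = r k}. \<Prod>i\<in>e. x i) + ?w / fact (r k - 1)))"
    unfolding Phi_at_def
  proof (intro sum_mono mult_left_mono)
    fix k assume k: "k \<in> {1..l}"
    let ?F = "{e\<in>edges H. card e = r k}"
    have "(\<Sum>e\<in>?F. \<Prod>i\<in>e. x i)
        \<le> (\<Sum>e\<in>sized_subsets U {r k} \<inter> ?F. \<Prod>i\<in>e. x i) + ?w / fact (r k - 1)"
    proof (rule edge_sum_le_induced[OF x fin])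
      show "0 < r k" using k r by fastforce
      show "?F \<subseteq> sized_subsets ?V {r k}" using E by (auto simp: sized_subsets_def)
    qed
    also have "(\<Sum>e\<in>sized_subsets U {r k} \<inter> ?F. \<Prod>i\<in>e. x i)
        \<le> (\<Sum>e\<in>{e\<in>Pow U. card e = r k}. \<Prod>i\<in>e. x i)"
      using nn finite_subset[OF U fin]
      by (intro sum_mono2 prod_nonneg) (auto simp: sized_subsets_def)
    finally show "(\<Sum>e\<in>?F. \<Prod>i\<in>e. x i)
        \<le> (\<Sum>e\<in>{e\<in>Pow U. card e = r k}. \<Prod>i\<in>e. x i) + ?w / fact (r k - 1)"
      by simp
    show "0 \<le> \<alpha> k" using \<alpha> k by (simp add: less_imp_le)
  qed
  also have "\<dots> = Phi_at l \<alpha> r (U, Pow U) x + ?w * (\<Sum>k=1..l. \<alpha> k / fact (r k - 1))"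
    by (simp add: Phi_at_def distrib_left sum.distrib sum_distrib_left mult.commute)
  also have "\<dots> \<le> Phi_at l \<alpha> r (U, Pow U) x + ?w"
    using w \<alpha>_sum by (simp add: mult_left_le)
  \<comment> \<open>Written this way, the lost mass cancels the singleton sum in
    \<open>L_at\<close>.\<close>
  also have "?w = 1 - (\<Sum>i\<in>U. x i)"
    using x sum_diff[OF fin U, of x] by (simp add: std_simplex_def)
  finally show ?thesis by (simp add: L_at_eq U_def)
qed

text \<open>Relabelling carries the polynomial from the vertices of \<open>H\<close> to the natural
  numbers, where the colex hypergraphs live.\<close>

lemma Phi_at_Pow_image:
  assumes "inj_on f S" "\<And>j. j \<in> S \<Longrightarrow> y j = x (f j)"
  shows "Phi_at l \<alpha> r (f ` S, Pow (f ` S)) x = Phi_at l \<alpha> r (S, Pow S) y"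
proof -
  have "(\<Sum>e\<in>{e\<in>Pow (f ` S). card e = k}. \<Prod>i\<in>e. x i) = (\<Sum>e\<in>{e\<in>Pow S. card e = k}. \<Prod>i\<in>e. y i)"
    for k
  proof -
    have inj: "inj_on ((`) f) {e\<in>Pow S. card e = k}"
      by (rule inj_on_subset[OF inj_on_image_Pow[OF assms(1)]]) auto
    have c: "card (f ` e) = card e" if "e \<subseteq> S" for e
      using that assms(1) by (meson card_image inj_on_subset)
    have "{e\<in>Pow (f ` S). card e = k} = (`) f ` {e\<in>Pow S. card e = k}"
      using c by (auto simp: subset_image_iff)
    then have "(\<Sum>e\<in>{e\<in>Pow (f ` S). card e = k}. \<Prod>i\<in>e. x i)
        = (\<Sum>e\<in>{e\<in>Pow S. card e = k}. \<Prod>i\<in>f ` e. x i)"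
      using inj by (simp add: sum.reindex)
    also have "\<dots> = (\<Sum>e\<in>{e\<in>Pow S. card e = k}. \<Prod>i\<in>e. y i)"
    proof (intro sum.cong refl)
      fix e assume e: "e \<in> {e\<in>Pow S. card e = k}"
      then have "(\<Prod>i\<in>f ` e. x i) = (\<Prod>i\<in>e. x (f i))"
        using assms(1) by (subst prod.reindex) (auto intro: inj_on_subset)
      also have "\<dots> = (\<Prod>i\<in>e. y i)" using e assms(2) by (intro prod.cong) auto
      finally show "(\<Prod>i\<in>f ` e. x i) = (\<Prod>i\<in>e. y i)" .
    qed
    finally show ?thesis .
  qed
  then show ?thesis by (simp add: Phi_at_def)
qed

text \<open>The mass outside the small vertex set is moved to the vertex \<open>t\<close>.\<close>

lemma Phi_at_Pow_transfer:
  fixes x :: "'a \<Rightarrow> real"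
  assumes "finite V" "x \<in> std_simplex V" "U \<subseteq> V" "card U \<le> t"
  obtains y where "y \<in> std_simplex {..<Suc t}"
    "Phi_at l \<alpha> r (U, Pow U) x = Phi_at l \<alpha> r ({..<card U}, Pow {..<card U}) y"
proof -
  obtain f where f: "bij_betw f {..<card U} U"
    using ex_bij_betw_nat_finite[of U] finite_subset[OF assms(3,1)] by (auto simp: lessThan_atLeast0)
  \<comment> \<open>As \<open>card U\<close> is at most \<open>t\<close>, the vertex
    \<open>t\<close> is outside \<open>{..<card U}\<close>, so the mass put there does not enter the
    polynomial.\<close>
  define y where "y j = (if j < card U then x (f j) else if j = t then 1 - (\<Sum>i\<in>U. x i) else 0)" for j
  have U: "(\<Sum>j<card U. y j) = (\<Sum>i\<in>U. x i)"
    using sum.reindex_bij_betw[OF f, of x] by (simp add: y_def)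
  have "(\<Sum>j<t. y j) = (\<Sum>j<card U. y j)"
    using assms(4) by (intro sum.mono_neutral_right) (auto simp: y_def)
  then have "(\<Sum>j<Suc t. y j) = 1"
    using U assms(4) by (simp add: y_def)
  then have "y \<in> std_simplex {..<Suc t}"
    using assms(4) std_simplex_range[OF assms(1,2)] singleton_sum_le[OF assms(1,2,3)]
    by (auto simp: std_simplex_def y_def)
  moreover have "Phi_at l \<alpha> r (U, Pow U) x = Phi_at l \<alpha> r ({..<card U}, Pow {..<card U}) y"
    using Phi_at_Pow_image[of f "{..<card U}" y x l \<alpha> r] f by (simp add: bij_betw_def y_def)
  ultimately show ?thesis by (rule that)
qed

text \<open>Used to discard edges of other sizes, such as the empty set in \<open>Pow U\<close>,
  before comparing with colex edges or applying the hypothesis on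
  \<open>Q\<close>-hypergraphs.\<close>

lemma Phi_at_sized:
  "Phi_at l \<alpha> r (W, E) x = Phi_at l \<alpha> r (W', {e\<in>E. card e \<in> r ` {1..l}}) x"
  unfolding Phi_at_def by (intro sum.cong arg_cong2[where f = "(*)"] refl) auto

text \<open>The vertices \<open>0\<close> to \<open>t\<close> are all the vertices of the colex
  hypergraph and all carry singleton edges, so on the simplex these contribute exactly 1. Both cases
  of the proof end here, with different \<open>F\<close>.\<close>

lemma L_colex_ge:
  assumes \<alpha>: "\<forall>k\<in>{1..l}. 0 < \<alpha> k"
    and lo: "card (sized_subsets {..<t} T) < m"
    and hi: "m \<le> card (sized_subsets {..<Suc t} T)"
    and "1 \<in> T" "0 \<notin> T"
    and y: "y \<in> std_simplex {..<Suc t}"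
    and F: "F \<subseteq> colex_edges m T"
  shows "1 + Phi_at l \<alpha> r (W, F) y \<le> L l \<alpha> r (colex_hypergraph m T)"
proof -
  let ?C = "colex_hypergraph m T"
  have sub: "edges ?C \<subseteq> sized_subsets {..<Suc t} T"
    using colex_edges_subset[OF hi] by (simp add: colex_hypergraph_def)
  have finE: "finite (edges ?C)"
    by (rule finite_subset[OF sub finite_sized_subsets]) simp
  \<comment> \<open>For \<open>i\<close> at most \<open>t\<close>, the predecessors of
    \<open>{i}\<close> lie in \<open>{..<t}\<close>, which by \<open>lo\<close> holds fewer than
    \<open>m\<close> admissible sets.\<close>
  have sing: "{i} \<in> edges ?C" if "i < Suc t" for i
  proof -
    have "{i} \<in> colex_edges m T"
    proof (rule colex_edges_memI[OF _ _ lo])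
      fix B assume "finite B" "colex_less B {i}"
      then have "B \<subseteq> {..<i}" by (intro colex_less_singleton_imp_subset)
      then show "B \<subseteq> {..<t}" using that by force
    qed (use \<open>1 \<in> T\<close> in auto)
    then show ?thesis by (simp add: colex_hypergraph_def)
  qed
  have U: "{i. {i} \<in> edges ?C} = {..<Suc t}"
    using sing sub by (force simp: sized_subsets_def)
  have "verts ?C = \<Union>(edges ?C)" by (simp add: colex_hypergraph_def)
  then have V: "verts ?C = {..<Suc t}"
    using sing sub unfolding sized_subsets_def by blast
  have hyp: "hypergraph ?C"
    unfolding hypergraph_def V using sub by (auto simp: sized_subsets_def)
  have "1 + Phi_at l \<alpha> r (W, F) y \<le> 1 + Phi_at l \<alpha> r ?C y"
    using \<alpha> F finE std_simplex_range[OF _ y]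
    by (intro add_left_mono Phi_at_mono) (auto simp: colex_hypergraph_def)
  also have "\<dots> = L_at l \<alpha> r ?C y"
    unfolding L_at_eq U using y by (simp add: std_simplex_def)
  also have "\<dots> \<le> L l \<alpha> r ?C"
    unfolding L_def using y V by (intro cSUP_upper bdd_above_L_at[OF hyp \<alpha>]) auto
  finally show ?thesis .
qed

section \<open>The two cases, by the number of singleton edges of \<open>H\<close>\<close>

theorem theorem10:
  fixes l m t n :: nat
    and r :: "nat \<Rightarrow> nat"
    and \<alpha> :: "nat \<Rightarrow> real"
    and T Q :: "nat set"
    and H :: "'a hypergraph"
  assumes "1 \<le> l"
    and "\<forall>i\<in>{1..l}. 1 < r i"
    and "strict_mono_on {1..l} r"
    and "\<forall>i\<in>{1..l}. 0 < \<alpha> i"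
    and "(\<Sum>i=1..l. \<alpha> i / fact (r i - 1)) \<le> 1"
    and "0 < m" and "0 < t"
    and "t + (\<Sum>i=1..l. t choose r i) < m"
    and "m \<le> t + 1 + (\<Sum>i=1..l. (t + 1) choose r i)"
    and "T = insert 1 (r ` {1..l})"
    and "Q = r ` {1..l}"
    and "T_hypergraph T H" and "card (edges H) = m" and "card (verts H) = n"
    and "\<forall>G :: 'a hypergraph.
           T_hypergraph Q G \<and> card (edges G) = m - t - 1 \<and> card (verts G) = n \<longrightarrow>
           Phi l \<alpha> r G \<le> Phi l \<alpha> r (colex_hypergraph (m - t - 1) Q)"
  shows "L l \<alpha> r H \<le> L l \<alpha> r (colex_hypergraph m T)"
proof -
  note r = assms(2) and \<alpha> = assms(4) and T = assms(10) and Q = assms(11)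
  have inj: "inj_on r {1..l}" using assms(3) by (rule strict_mono_on_imp_inj_on)
  have Q1: "1 \<notin> Q" "0 \<notin> Q" "finite Q" "Q \<noteq> {}" using r Q assms(1) by force+
  have TQ: "T = insert 1 Q" using T Q by simp
  have cQ: "card (sized_subsets X Q) = (\<Sum>i=1..l. card X choose r i)" if "finite X" for X :: "'b set"
    using that Q1 inj by (simp add: card_sized_subsets) (simp add: Q sum.reindex)
  have cT: "card (sized_subsets X T) = card X + card (sized_subsets X Q)" if "finite X" for X :: "'b set"
    using that Q1 by (simp add: card_sized_subsets TQ)
  \<comment> \<open>The bounds on \<open>m\<close> compare it with the numbers of sets with sizes in
    \<open>T\<close> on \<open>t\<close> and on \<open>t + 1\<close> vertices.\<close>
  have lo: "card (sized_subsets {..<t} T) < m"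
    using assms(8) by (simp add: cT cQ)
  have hi: "m \<le> card (sized_subsets {..<Suc t} T)"
    using assms(9) by (simp add: cT cQ)
  have T01: "1 \<in> T" "0 \<notin> T" using TQ Q1 by auto
  note ge = L_colex_ge[OF \<alpha> lo hi T01]

  let ?V = "verts H" and ?E = "edges H"
  have hyp: "hypergraph H" and types: "card ` ?E = T"
    using assms(12) by (auto simp: T_hypergraph_def edge_types_def)
  have fin: "finite ?V" and E: "\<And>e. e \<in> ?E \<Longrightarrow> e \<subseteq> ?V" using hyp by (auto simp: hypergraph_def)
  have finE: "finite ?E" by (rule finite_subset[of _ "Pow ?V"]) (use E fin in auto)
  define U where "U = {i. {i} \<in> ?E}"
  have U: "U \<subseteq> ?V" using E by (auto simp: U_def)
  \<comment> \<open>A singleton edge exists because the size 1 must occur in \<open>H\<close>; its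
    vertex makes the simplex nonempty for the final supremum.\<close>
  obtain v where v: "v \<in> ?V"
  proof -
    obtain e where "e \<in> ?E" "card e = 1" using types T01(1) by (metis imageE)
    then show ?thesis using E that by (auto simp: card_1_singleton_iff)
  qed

  have "L_at l \<alpha> r H x \<le> L l \<alpha> r (colex_hypergraph m T)" if x: "x \<in> std_simplex ?V" for x
  proof (cases "card U \<le> t")
    case True
    obtain y where y: "y \<in> std_simplex {..<Suc t}"
      "Phi_at l \<alpha> r (U, Pow U) x = Phi_at l \<alpha> r ({..<card U}, Pow {..<card U}) y"
      using Phi_at_Pow_transfer[OF fin x U True] by blast
    have sub: "{e\<in>Pow {..<card U}. card e \<in> r ` {1..l}} \<subseteq> colex_edges m T"
    proof
      fix e assume e: "e \<in> {e\<in>Pow {..<card U}. card e \<in> r ` {1..l}}"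
      then have et: "e \<subseteq> {..<t}" "finite e" using True by (auto intro: finite_subset)
      show "e \<in> colex_edges m T"
        by (rule colex_edges_memI[OF et(2) _ lo])
           (use e et T in \<open>auto dest: colex_less_imp_subset\<close>)
    qed
    have "L_at l \<alpha> r H x \<le> 1 + Phi_at l \<alpha> r (U, Pow U) x"
      unfolding U_def by (rule L_at_le_induced[OF hyp x r \<alpha> assms(5)])
    also have "\<dots> = 1 + Phi_at l \<alpha> r ({}, {e\<in>Pow {..<card U}. card e \<in> r ` {1..l}}) y"
      unfolding y(2) by (subst Phi_at_sized[where W' = "{}"]) simp
    also have "\<dots> \<le> L l \<alpha> r (colex_hypergraph m T)"
      by (rule ge[OF y(1) sub])
    finally show ?thesis .
  next
    case False
    let ?EQ = "{e\<in>?E. card e \<in> Q}" and ?m = "m - t - 1"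
    have split: "?E = ?EQ \<union> (\<lambda>i. {i}) ` U"
    proof (intro equalityI subsetI)
      fix e assume e: "e \<in> ?E"
      then have "card e = 1 \<or> card e \<in> Q" using types TQ by blast
      with e show "e \<in> ?EQ \<union> (\<lambda>i. {i}) ` U" by (auto simp: U_def card_1_singleton_iff)
    qed (auto simp: U_def)
    have "card (?EQ \<union> (\<lambda>i. {i}) ` U) = card ?EQ + card ((\<lambda>i. {i}) ` U)"
      using finE Q1 finite_subset[OF U fin] by (intro card_Un_disjoint) auto
    then have "m = card ?EQ + card ((\<lambda>i. {i}) ` U)"
      using assms(13) arg_cong[OF split, of card] by linarith
    then have mU: "m = card ?EQ + card U" by (simp add: card_image)
    have cEQ: "card ?EQ \<le> ?m" using mU False by simp
    \<comment> \<open>Every size in \<open>T\<close> occurs in \<open>H\<close>, so some edge has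
      size in \<open>Q\<close>. Hence \<open>m - t - 1\<close> is positive: the subtraction is not
      truncated and the colex hypergraph on \<open>Q\<close> has an edge.\<close>
    obtain e where "e \<in> ?E" "card e \<in> Q" using types TQ Q1(4) by (metis all_not_in_conv imageE insertCI)
    then have "?EQ \<noteq> {}" by blast
    then have "0 < card ?EQ" using finE by (intro card_gt_0_iff[THEN iffD2]) simp
    then have m_pos: "0 < ?m" using cEQ by (rule less_le_trans)
    \<comment> \<open>There is room to add edges: \<open>H\<close> has at least \<open>t + 1\<close>
      vertices, hence at least \<open>m - t - 1\<close> vertex sets with sizes in
      \<open>Q\<close>.\<close>
    have "?m \<le> card (sized_subsets {..<Suc t} Q)" using hi by (simp add: cT)
    also have "\<dots> \<le> card (sized_subsets ?V Q)"
      using False card_mono[OF fin U] by (auto simp: cQ fin intro!: sum_mono binomial_right_mono)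
    finally have "?m \<le> card (sized_subsets ?V Q)" .
    moreover have "?EQ \<subseteq> sized_subsets ?V Q" using E by (auto simp: sized_subsets_def)
    ultimately obtain F where F: "?EQ \<subseteq> F" "F \<subseteq> sized_subsets ?V Q" "card F = ?m"
      using exists_subset_between[OF cEQ _ _ finite_sized_subsets[OF fin]] by blast
    have finF: "finite F" by (rule finite_subset[OF F(2) finite_sized_subsets[OF fin]])
    \<comment> \<open>The hypothesis demands that every size in \<open>Q\<close> occur; the edges
      inherited from \<open>H\<close> already provide them all.\<close>
    have "card ` F = Q"
    proof
      show "card ` F \<subseteq> Q" using F(2) by (auto simp: sized_subsets_def)
      show "Q \<subseteq> card ` F"
      proof
        fix q assume q: "q \<in> Q"
        then obtain e where "e \<in> ?E" "q = card e" using types TQ by (metis imageE insertCI)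
        then show "q \<in> card ` F" using F(1) q by blast
      qed
    qed
    then have "T_hypergraph Q (?V, F)"
      using F(2) fin by (auto simp: T_hypergraph_def edge_types_def hypergraph_def sized_subsets_def)
    then have PhiG: "Phi l \<alpha> r (?V, F) \<le> Phi l \<alpha> r (colex_hypergraph ?m Q)"
      using assms(14,15) F(3) by simp
    have "L_at l \<alpha> r H x \<le> 1 + Phi_at l \<alpha> r H x"
      unfolding L_at_eq using singleton_sum_le[OF fin x U] by (simp add: U_def)
    also have "Phi_at l \<alpha> r H x = Phi_at l \<alpha> r (?V, ?EQ) x"
      using Phi_at_sized[of l \<alpha> r ?V ?E x ?V] by (simp add: Q)
    also have "\<dots> \<le> Phi_at l \<alpha> r (?V, F) x"
      using F finF std_simplex_range[OF fin x] \<alpha> by (intro Phi_at_mono) auto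
    also have "\<dots> \<le> Phi l \<alpha> r (?V, F)"
      unfolding Phi_def using x by (intro cSUP_upper) (auto intro: bdd_above_Phi_at[OF fin \<alpha>])
    also note PhiG
    also have "Phi l \<alpha> r (colex_hypergraph ?m Q) \<le> L l \<alpha> r (colex_hypergraph m T) - 1"
    proof -
      let ?C = "colex_hypergraph ?m Q"
      have Csub: "colex_edges ?m Q \<subseteq> sized_subsets {..<Suc t} Q"
        using hi by (intro colex_edges_subset) (simp add: cT)
      then have V: "verts ?C \<subseteq> {..<Suc t}"
        by (auto simp: colex_hypergraph_def sized_subsets_def)
      \<comment> \<open>Admitting singletons adds at most \<open>t + 1\<close> predecessors, and the
        cutoff rises from \<open>m - t - 1\<close> to \<open>m\<close> by the same amount.\<close>
      have CT: "colex_edges ?m Q \<subseteq> colex_edges m T"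
      proof
        fix A assume "A \<in> colex_edges ?m Q"
        with Csub have "A \<in> colex_edges (?m + Suc t) (insert 1 Q)"
          by (intro colex_edges_insert_1) (auto simp: sized_subsets_def)
        then show "A \<in> colex_edges m T" using m_pos by (simp add: TQ)
      qed
      \<comment> \<open>The set \<open>{..<Min Q}\<close> has no predecessors, so it is an edge; it
        contains \<open>0\<close>, which makes the simplex nonempty as \<open>cSUP_least\<close>
        requires.\<close>
      have minQ: "Min Q \<in> Q" using Q1 by simp
      then have "{..<Min Q} \<in> edges ?C"
        using Q1 m_pos colex_predecessors_empty[of Q "Min Q"]
        by (simp add: colex_edges_def colex_hypergraph_def)
      moreover have "0 \<in> {..<Min Q}" using minQ Q1 by (metis gr0I lessThan_iff)
      ultimately have "0 \<in> verts ?C" unfolding colex_hypergraph_def by auto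
      moreover have "finite (verts ?C)" using V finite_subset by blast
      ultimately have ne: "std_simplex (verts ?C) \<noteq> {}" by (intro std_simplex_nonempty)
      show ?thesis unfolding Phi_def
      proof (rule cSUP_least[OF ne])
        fix y assume "y \<in> std_simplex (verts ?C)"
        then have "y \<in> std_simplex {..<Suc t}" using V by (rule std_simplex_mono) simp
        from ge[OF this CT, of r "verts ?C"]
        show "Phi_at l \<alpha> r ?C y \<le> L l \<alpha> r (colex_hypergraph m T) - 1"
          by (simp add: colex_hypergraph_def)
      qed
    qed
    finally show ?thesis by simp
  qed
  then show ?thesis
    unfolding L_def[of l \<alpha> r H] by (intro cSUP_least std_simplex_nonempty[OF fin v])
qed

end
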